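(* Let $(\mathbb{R}^n,g)$ be a pseudo-Euclidean space, $n\ge 3$, with coordinates $x=(x_1,\dots,x_n)$ and $g_{ij}=\delta_{ij}\varepsilon_i$, $\varepsilon_i=\pm1$. Let $f,\varphi,h:\mathbb{R}^n\to\mathbb{R}$ be smooth functions with $f$ positive and $\varphi$ nowhere zero, let $\overline g=\frac{1}{\varphi^2}g$, let $F^m$, $m\ge1$, be a semi-Riemannian Einstein manifold with constant Ricci curvature $\lambda_F$, and let $M=(\mathbb{R}^n,\overline g)\times_fF^m$ be the warped product. Let $\rho\in\mathbb{R}$. Then the warped product metric $\widetilde g=\overline g+f^2g_F$ is a gradient Ricci soliton with $h$ as potential function, i.e. $\mathrm{Ric}_{\widetilde g}+\mathrm{Hess}_{\widetilde g}(h)=\rho\widetilde g$, if and only if $f,\varphi,h$ satisfy: (1) for all $1\le i\ne j\le n$, $$(n-2)f\varphi_{,x_ix_j}+f\varphi h_{,x_ix_j}-m\varphi f_{,x_ix_j}-m\varphi_{,x_i}f_{,x_j}-m\varphi_{,x_j}f_{,x_i}+f\varphi_{,x_i}h_{,x_j}+f\varphi_{,x_j}h_{,x_i}=0;$$ (2) for all $1\le i\le n$, $$\varphi\big[(n-2)f\varphi_{,x_ix_i}+f\varphi h_{,x_ix_i}-m\varphi f_{,x_ix_i}-2m\varphi_{,x_i}f_{,x_i}+2f\varphi_{,x_i}h_{,x_i}\big]+\varepsilon_i\sum_{k=1}^n\varepsilon_k\big[f\varphi\varphi_{,x_kx_k}-(n-1)f\varphi_{,x_k}^2+m\varphi\varphi_{,x_k}f_{,x_k}-f\varphi\varphi_{,x_k}h_{,x_k}\big]=\varepsilon_i\rho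 f;$$ (3) $$\sum_{k=1}^n\varepsilon_k\big[-f\varphi^2f_{,x_kx_k}+(n-2)f\varphi f_{,x_k}\varphi_{,x_k}-(m-1)\varphi^2f_{,x_k}^2+f\varphi^2f_{,x_k}h_{,x_k}\big]=\rho f^2-\lambda_F.$$
   Context: Subscripts $_{,x_i}$ and $_{,x_ix_j}$ denote first and second order partial derivatives. The warped product $B\times_fF$ of semi-Riemannian manifolds $(B,g_B)$, $(F,g_F)$ with warping function $f>0$ on $B$ is $B\times F$ with metric $g_B+f^2g_F$. The function $h$ on $\mathbb{R}^n$ is regarded as a function on $M$ via the projection. $F$ having constant Ricci curvature $\lambda_F$ means $\mathrm{Ric}_{g_F}=\lambda_Fg_F$; when $m=1$, $\lambda_F=0$. *)

theory Defs
  imports "HOL-Analysis.Analysis"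
begin

definition partial_deriv :: "'n::finite \<Rightarrow> (real^'n \<Rightarrow> real) \<Rightarrow> real^'n \<Rightarrow> real" ("\<partial>")
  where "\<partial> i f x = deriv (\<lambda>t. f (x + t *\<^sub>R axis i 1)) 0"

(* Only meant for open S, where it is the class C^k. *)
primrec Ck_on :: "nat \<Rightarrow> (real^'n::finite) set \<Rightarrow> (real^'n \<Rightarrow> real) \<Rightarrow> bool"
  where
    "Ck_on 0 S f \<longleftrightarrow> continuous_on S f"
  | "Ck_on (Suc k) S f \<longleftrightarrow> f differentiable_on S \<and> (\<forall>i. Ck_on k S (\<partial> i f))"

definition smooth_on :: "(real^'n::finite) set \<Rightarrow> (real^'n \<Rightarrow> real) \<Rightarrow> bool"
  where "smooth_on S f \<longleftrightarrow> (\<forall>k. Ck_on k S f)"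

(* A semi-Riemannian manifold is presented by an atlas in which every chart carries the matrix
   g_ij = g(d/dx_i, d/dx_j) of the metric in the coordinate frame of that chart, as a function
   of the point. That the local matrices define one tensor field is the transformation law in
   the definition of semi_riemannian_manifold. The values of chart_map and chart_metric outside
   chart_dom are irrelevant. *)
record ('a, 'n::finite) metric_chart =
  chart_dom :: "'a set"
  chart_map :: "'a \<Rightarrow> real^'n"
  chart_metric :: "'a \<Rightarrow> real^'n^'n"

definition chart_inv :: "('a, 'n::finite) metric_chart \<Rightarrow> real^'n \<Rightarrow> 'a"
  where "chart_inv c = inv_into (chart_dom c) (chart_map c)"

(* The coordinate vector field d/dx_i of the chart c, applied to u at the point p. *)
definition coord_deriv ::
    "('a, 'n::finite) metric_chart \<Rightarrow> 'n \<Rightarrow> ('a \<Rightarrow> real) \<Rightarrow> 'a \<Rightarrow> real"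
  where "coord_deriv c i u p = \<partial> i (u \<circ> chart_inv c) (chart_map c p)"

(* The index of the symmetric bilinear form with matrix G. *)
definition form_index :: "real^'n^'n::finite \<Rightarrow> nat"
  where "form_index G =
    Max {dim V | V. subspace V \<and> (\<forall>v\<in>V. v \<noteq> 0 \<longrightarrow> v \<bullet> (G *v v) < 0)}"

definition smooth_atlas ::
    "('a::{t2_space,second_countable_topology}, 'n::finite) metric_chart set \<Rightarrow> bool"
  where "smooth_atlas M \<longleftrightarrow>
    (\<Union>c\<in>M. chart_dom c) = UNIV \<and>
    (\<forall>c\<in>M. open (chart_dom c) \<and> open (chart_map c ` chart_dom c) \<and>
       homeomorphism (chart_dom c) (chart_map c ` chart_dom c) (chart_map c) (chart_inv c)) \<and>
    (\<forall>c\<in>M. \<forall>d\<in>M. \<forall>a.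
       smooth_on (chart_map c ` (chart_dom c \<inter> chart_dom d))
         (\<lambda>x. chart_map d (chart_inv c x) $ a))"

definition semi_riemannian_manifold ::
    "('a::{t2_space,second_countable_topology}, 'n::finite) metric_chart set \<Rightarrow> bool"
  where "semi_riemannian_manifold M \<longleftrightarrow>
    smooth_atlas M \<and>
    (\<forall>c\<in>M. \<forall>i j. smooth_on (chart_map c ` chart_dom c)
       (\<lambda>x. chart_metric c (chart_inv c x) $ i $ j)) \<and>
    (\<forall>c\<in>M. \<forall>p\<in>chart_dom c.
       transpose (chart_metric c p) = chart_metric c p \<and> invertible (chart_metric c p)) \<and>
    (\<forall>c\<in>M. \<forall>d\<in>M. \<forall>p\<in>chart_dom c \<inter> chart_dom d. \<forall>i j.
       chart_metric c p $ i $ j =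
         (\<Sum>a\<in>UNIV. \<Sum>b\<in>UNIV.
            coord_deriv c i (\<lambda>q. chart_map d q $ a) p *
            coord_deriv c j (\<lambda>q. chart_map d q $ b) p * chart_metric d p $ a $ b)) \<and>
    (\<exists>\<nu>. \<forall>c\<in>M. \<forall>p\<in>chart_dom c. form_index (chart_metric c p) = \<nu>)"

(* christoffel c k i j is the Christoffel symbol of the second kind with upper index k. *)
definition christoffel ::
    "('a, 'n::finite) metric_chart \<Rightarrow> 'n \<Rightarrow> 'n \<Rightarrow> 'n \<Rightarrow> 'a \<Rightarrow> real"
  where "christoffel c k i j p =
    (1/2) * (\<Sum>l\<in>UNIV. matrix_inv (chart_metric c p) $ k $ l *
      (coord_deriv c i (\<lambda>q. chart_metric c q $ j $ l) p
       + coord_deriv c j (\<lambda>q. chart_metric c q $ i $ l) p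
       - coord_deriv c l (\<lambda>q. chart_metric c q $ i $ j) p))"

(* riemann c l k i j is the d/dx_l component of R(d/dx_i, d/dx_j) d/dx_k, where
   R(X,Y)Z = D_X D_Y Z - D_Y D_X Z - D_[X,Y] Z. *)
definition riemann ::
    "('a, 'n::finite) metric_chart \<Rightarrow> 'n \<Rightarrow> 'n \<Rightarrow> 'n \<Rightarrow> 'n \<Rightarrow> 'a \<Rightarrow> real"
  where "riemann c l k i j p =
    coord_deriv c i (christoffel c l j k) p - coord_deriv c j (christoffel c l i k) p
    + (\<Sum>s\<in>UNIV. christoffel c l i s p * christoffel c s j k p
                 - christoffel c l j s p * christoffel c s i k p)"

(* Ric(Y,Z) is the trace of X \<mapsto> R(X,Y)Z, so that round spheres have positive Ricci curvature. *)
definition ricci :: "('a, 'n::finite) metric_chart \<Rightarrow> 'n \<Rightarrow> 'n \<Rightarrow> 'a \<Rightarrow> real"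
  where "ricci c i j p = (\<Sum>s\<in>UNIV. riemann c s j s i p)"

definition hessian ::
    "('a, 'n::finite) metric_chart \<Rightarrow> ('a \<Rightarrow> real) \<Rightarrow> 'n \<Rightarrow> 'n \<Rightarrow> 'a \<Rightarrow> real"
  where "hessian c u i j p =
    coord_deriv c i (coord_deriv c j u) p
    - (\<Sum>k\<in>UNIV. christoffel c k i j p * coord_deriv c k u p)"

definition constant_ricci_curvature :: "('a, 'n::finite) metric_chart set \<Rightarrow> real \<Rightarrow> bool"
  where "constant_ricci_curvature M K \<longleftrightarrow>
    (\<forall>c\<in>M. \<forall>p\<in>chart_dom c. \<forall>i j. ricci c i j p = K * chart_metric c p $ i $ j)"

definition gradient_ricci_soliton ::
    "('a, 'n::finite) metric_chart set \<Rightarrow> ('a \<Rightarrow> real) \<Rightarrow> real \<Rightarrow> bool"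
  where "gradient_ricci_soliton M u \<rho> \<longleftrightarrow>
    (\<forall>c\<in>M. \<forall>p\<in>chart_dom c. \<forall>i j.
       ricci c i j p + hessian c u i j p = \<rho> * chart_metric c p $ i $ j)"

definition pseudo_euclidean :: "('n::finite \<Rightarrow> real) \<Rightarrow> (real^'n, 'n) metric_chart set"
  where "pseudo_euclidean \<epsilon> =
    {\<lparr>chart_dom = UNIV, chart_map = (\<lambda>x. x),
      chart_metric = (\<lambda>x. \<chi> i j. if i = j then \<epsilon> i else 0)\<rparr>}"

(* The metric g / \<phi>^2. *)
definition conformal_metric ::
    "('a \<Rightarrow> real) \<Rightarrow> ('a, 'n::finite) metric_chart set \<Rightarrow> ('a, 'n) metric_chart set"
  where "conformal_metric \<phi> M =
    (\<lambda>c. c\<lparr>chart_metric := (\<lambda>p. (1 / (\<phi> p)\<^sup>2) *\<^sub>R chart_metric c p)\<rparr>) ` M"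

(* The product chart, with coordinates indexed by the disjoint sum, and with the matrix of
   g_B + f^2 g_F. *)
definition warped_chart ::
    "('a, 'n::finite) metric_chart \<Rightarrow> ('a \<Rightarrow> real) \<Rightarrow> ('b, 'm::finite) metric_chart
      \<Rightarrow> ('a \<times> 'b, 'n + 'm) metric_chart"
  where "warped_chart b f c =
    \<lparr>chart_dom = chart_dom b \<times> chart_dom c,
     chart_map = (\<lambda>(p, q). \<chi> s. case s of Inl i \<Rightarrow> chart_map b p $ i | Inr a \<Rightarrow> chart_map c q $ a),
     chart_metric = (\<lambda>(p, q). \<chi> s t.
       case (s, t) of
         (Inl i, Inl j) \<Rightarrow> chart_metric b p $ i $ j
       | (Inr a, Inr a') \<Rightarrow> (f p)\<^sup>2 * chart_metric c q $ a $ a'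
       | _ \<Rightarrow> 0)\<rparr>"

definition warped_product ::
    "('a, 'n::finite) metric_chart set \<Rightarrow> ('a \<Rightarrow> real) \<Rightarrow> ('b, 'm::finite) metric_chart set
      \<Rightarrow> ('a \<times> 'b, 'n + 'm) metric_chart set"
  where "warped_product B f F = {warped_chart b f c | b c. b \<in> B \<and> c \<in> F}"

end

theory Submission
  imports Defs
begin

text \<open>Coordinate derivatives on a product chart split into derivatives on the two factors, and the
  matrix of a warped metric is block diagonal. Hence the Christoffel symbols of a warped product
  reduce to those of the factors, with the only new ones being \<open>\<Gamma>\<^bsup>k\<^esup>\<^bsub>ab\<^esub> = - f (grad f)\<^bsup>k\<^esup> g\<^bsub>ab\<^esub>\<close> and
  \<open>\<Gamma>\<^bsup>a\<^esup>\<^bsub>ib\<^esub> = \<delta>\<^bsup>a\<^esup>\<^bsub>b\<^esub> \<partial>\<^bsub>i\<^esub>f / f\<close>, and O'Neill's formulas follow: the mixed part of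
  Ric + Hess vanishes, the base part is \<open>Ric - (m/f) Hess f + Hess h\<close>, and the fibre part is a
  function on the base times \<open>g\<^bsub>F\<^esub>\<close> because the fibre is Einstein. For the conformally flat base
  everything is expressed through \<open>u\<^bsub>i\<^esub> = \<partial>\<^bsub>i\<^esub>\<phi> / \<phi>\<close>, and the base equations become (1) and (2) after
  multiplication by \<open>f \<phi>\<close> and \<open>f \<phi>\<^sup>2\<close>.\<close>


section \<open>Derivatives along coordinate curves\<close>

text \<open>\<open>coord_deriv\<close> rests on \<open>deriv\<close>, which has a value even where
  no derivative exists. This relational form also asserts existence, so the sum, product and
  quotient rules can be chained.\<close>

definition has_coord_deriv ::
    "('a, 'n::finite) metric_chart \<Rightarrow> 'n \<Rightarrow> ('a \<Rightarrow> real) \<Rightarrow> real \<Rightarrow> 'a \<Rightarrow> bool"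
  where "has_coord_deriv c i u D p \<longleftrightarrow>
    ((\<lambda>t. u (chart_inv c (chart_map c p + t *\<^sub>R axis i 1))) has_real_derivative D) (at 0)"

lemma has_coord_deriv_imp_eq: "has_coord_deriv c i u D p \<Longrightarrow> coord_deriv c i u p = D"
  by (simp add: has_coord_deriv_def coord_deriv_def partial_deriv_def DERIV_imp_deriv)

text \<open>Injectivity makes \<open>chart_inv\<close> a true inverse on the domain; openness of the
  image keeps short coordinate curves inside the chart.\<close>

locale regular_chart =
  fixes c :: "('a, 'n::finite) metric_chart"
  assumes inj_chart: "inj_on (chart_map c) (chart_dom c)"
    and open_image: "open (chart_map c ` chart_dom c)"
begin

lemma chart_inv_map [simp]: "p \<in> chart_dom c \<Longrightarrow> chart_inv c (chart_map c p) = p"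
  by (simp add: chart_inv_def inj_chart)

lemma map_chart_inv: "y \<in> chart_map c ` chart_dom c \<Longrightarrow> chart_map c (chart_inv c y) = y"
  by (simp add: chart_inv_def f_inv_into_f)

lemma chart_inv_mem: "y \<in> chart_map c ` chart_dom c \<Longrightarrow> chart_inv c y \<in> chart_dom c"
  by (simp add: chart_inv_def inv_into_into)

lemma eventually_curve_in_image:
  assumes "p \<in> chart_dom c"
  shows "\<forall>\<^sub>F t in nhds 0. chart_map c p + t *\<^sub>R axis i 1 \<in> chart_map c ` chart_dom c"
proof -
  have "((\<lambda>t. chart_map c p + t *\<^sub>R axis i (1::real)) \<longlongrightarrow> chart_map c p + 0 *\<^sub>R axis i 1) (nhds 0)"
    by (intro tendsto_intros filterlim_ident)
  then show ?thesis
    using topological_tendstoD[OF _ open_image] assms by auto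
qed

text \<open>Only the germ of the coordinate curve at 0 matters, and it lies in the open image.
  Identities valid merely on the chart domain may therefore be differentiated.\<close>

lemma coord_deriv_cong:
  assumes "p \<in> chart_dom c" "\<And>p'. p' \<in> chart_dom c \<Longrightarrow> u p' = v p'"
  shows "coord_deriv c i u p = coord_deriv c i v p"
  unfolding coord_deriv_def partial_deriv_def o_def
  by (rule deriv_cong_ev[OF eventually_mono[OF eventually_curve_in_image[OF assms(1), of i]]])
     (auto simp: assms(2) chart_inv_mem)

lemma coord_deriv_const [simp]: "coord_deriv c i (\<lambda>_. k) = (\<lambda>_. 0)"
  by (rule ext) (simp add: coord_deriv_def partial_deriv_def o_def)

lemma has_coord_deriv_const: "has_coord_deriv c i (\<lambda>_. k) 0 p"
  by (simp add: has_coord_deriv_def)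

lemma has_coord_deriv_add:
  "has_coord_deriv c i u D p \<Longrightarrow> has_coord_deriv c i v E p
    \<Longrightarrow> has_coord_deriv c i (\<lambda>p. u p + v p) (D + E) p"
  unfolding has_coord_deriv_def by (rule DERIV_add)

lemma has_coord_deriv_minus:
  "has_coord_deriv c i u D p \<Longrightarrow> has_coord_deriv c i (\<lambda>p. - u p) (- D) p"
  unfolding has_coord_deriv_def by (rule DERIV_minus)

lemma has_coord_deriv_diff:
  "has_coord_deriv c i u D p \<Longrightarrow> has_coord_deriv c i v E p
    \<Longrightarrow> has_coord_deriv c i (\<lambda>p. u p - v p) (D - E) p"
  unfolding has_coord_deriv_def by (rule DERIV_diff)

lemma has_coord_deriv_cmult:
  "has_coord_deriv c i u D p \<Longrightarrow> has_coord_deriv c i (\<lambda>p. k * u p) (k * D) p"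
  unfolding has_coord_deriv_def by (rule DERIV_cmult)

text \<open>The factors are evaluated at the start of the curve, and
  \<open>chart_inv c (chart_map c p)\<close> is known to be \<open>p\<close> because
  \<open>p\<close> lies in the chart domain.\<close>

lemma has_coord_deriv_mult:
  assumes "has_coord_deriv c i u D p" "has_coord_deriv c i v E p" "p \<in> chart_dom c"
  shows "has_coord_deriv c i (\<lambda>p. u p * v p) (D * v p + E * u p) p"
  using DERIV_mult[OF assms(1,2)[unfolded has_coord_deriv_def]] assms(3)
  by (simp add: has_coord_deriv_def)

lemma has_coord_deriv_divide:
  assumes "has_coord_deriv c i u D p" "has_coord_deriv c i v E p" "p \<in> chart_dom c" "v p \<noteq> 0"
  shows "has_coord_deriv c i (\<lambda>p. u p / v p) ((D * v p - u p * E) / (v p * v p)) p"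
  using DERIV_divide[OF assms(1,2)[unfolded has_coord_deriv_def]] assms(3,4)
  by (simp add: has_coord_deriv_def)

end


section \<open>Symmetry of second partial derivatives\<close>

lemma smooth_on_UNIV_D:
  assumes "smooth_on UNIV (f :: real^'n::finite \<Rightarrow> real)"
  shows "smooth_on UNIV (\<partial> i f)" "f differentiable_on UNIV" "continuous_on UNIV f"
proof -
  have "Ck_on (Suc k) UNIV f" for k
    using assms by (auto simp: smooth_on_def)
  then show "smooth_on UNIV (\<partial> i f)" "f differentiable_on UNIV"
    by (auto simp: smooth_on_def)
  then show "continuous_on UNIV f"
    by (simp add: differentiable_imp_continuous_on)
qed

lemma has_partial_deriv:
  fixes f :: "real^'n::finite \<Rightarrow> real"
  assumes "f differentiable at (x + t *\<^sub>R axis i 1)"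
  shows "((\<lambda>t. f (x + t *\<^sub>R axis i 1)) has_real_derivative \<partial> i f (x + t *\<^sub>R axis i 1)) (at t)"
proof -
  have D: "((\<lambda>s. f (y + s *\<^sub>R axis i 1)) has_real_derivative frechet_derivative f (at (y + s *\<^sub>R axis i 1)) (axis i 1)) (at s)"
    if "f differentiable at (y + s *\<^sub>R axis i 1)" for y s
  proof -
    have line: "((\<lambda>s. y + s *\<^sub>R axis i (1::real)) has_derivative (\<lambda>s. s *\<^sub>R axis i 1)) (at s)"
      by (auto intro!: derivative_eq_intros)
    have f: "(f has_derivative frechet_derivative f (at (y + s *\<^sub>R axis i 1))) (at (y + s *\<^sub>R axis i 1))"
      using that frechet_derivative_works by blast
    have "((\<lambda>s. f (y + s *\<^sub>R axis i 1)) has_derivative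
        (\<lambda>r. frechet_derivative f (at (y + s *\<^sub>R axis i 1)) (r *\<^sub>R axis i 1))) (at s)"
      by (rule has_derivative_compose[OF line f])
    moreover have "frechet_derivative f (at (y + s *\<^sub>R axis i 1)) (r *\<^sub>R axis i 1)
        = r * frechet_derivative f (at (y + s *\<^sub>R axis i 1)) (axis i 1)" for r
      using has_derivative_linear[OF f] by (simp add: linear_cmul)
    ultimately show ?thesis
      by (simp add: has_field_derivative_def mult_commute_abs)
  qed
  \<comment> \<open>\<open>\<partial>\<close> differentiates at parameter 0 of a line through the
    given point, so \<open>D\<close> is used with the base point moved to
    \<open>x + t *\<^sub>R axis i 1\<close>.\<close>
  have "\<partial> i f (x + t *\<^sub>R axis i 1) = frechet_derivative f (at (x + t *\<^sub>R axis i 1)) (axis i 1)"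
    unfolding partial_deriv_def using DERIV_imp_deriv[OF D[of "x + t *\<^sub>R axis i 1" 0]] assms by simp
  then show ?thesis
    using D[OF assms] by simp
qed

text \<open>Two mean value steps: first in direction \<open>i\<close> for the difference of
  \<open>f\<close> along two parallel segments, then in direction \<open>j\<close> for
  \<open>\<partial> i f\<close> at the intermediate parameter found.\<close>

lemma second_difference_mean_value:
  fixes f :: "real^'n::finite \<Rightarrow> real"
  assumes f: "smooth_on UNIV f" and "r > 0"
  shows "\<exists>s t. 0 < s \<and> s < r \<and> 0 < t \<and> t < r \<and>
    f (x + r *\<^sub>R axis i 1 + r *\<^sub>R axis j 1) - f (x + r *\<^sub>R axis i 1) - f (x + r *\<^sub>R axis j 1) + f x
      = r * r * \<partial> j (\<partial> i f) (x + s *\<^sub>R axis i 1 + t *\<^sub>R axis j 1)"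
proof -
  have df: "f differentiable at y" "\<partial> i f differentiable at y" for y
    using smooth_on_UNIV_D(2)[OF f] smooth_on_UNIV_D(2)[OF smooth_on_UNIV_D(1)[OF f]]
    by (auto simp: differentiable_on_def)
  let ?g = "\<lambda>s. f ((x + r *\<^sub>R axis j 1) + s *\<^sub>R axis i 1) - f (x + s *\<^sub>R axis i 1)"
  have "(?g has_real_derivative
      \<partial> i f ((x + r *\<^sub>R axis j 1) + s *\<^sub>R axis i 1) - \<partial> i f (x + s *\<^sub>R axis i 1)) (at s)" for s
    by (intro DERIV_diff has_partial_deriv df)
  from MVT2[OF \<open>r > 0\<close> this] obtain s where s: "0 < s" "s < r"
    "?g r - ?g 0 = r * (\<partial> i f ((x + r *\<^sub>R axis j 1) + s *\<^sub>R axis i 1) - \<partial> i f (x + s *\<^sub>R axis i 1))"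
    by auto
  have "((\<lambda>t. \<partial> i f ((x + s *\<^sub>R axis i 1) + t *\<^sub>R axis j 1)) has_real_derivative
      \<partial> j (\<partial> i f) ((x + s *\<^sub>R axis i 1) + t *\<^sub>R axis j 1)) (at t)" for t
    by (intro has_partial_deriv df)
  from MVT2[OF \<open>r > 0\<close> this] obtain t where t: "0 < t" "t < r"
    "\<partial> i f ((x + s *\<^sub>R axis i 1) + r *\<^sub>R axis j 1) - \<partial> i f (x + s *\<^sub>R axis i 1)
      = r * \<partial> j (\<partial> i f) ((x + s *\<^sub>R axis i 1) + t *\<^sub>R axis j 1)"
    by auto
  show ?thesis
    using s t by (intro exI[of _ s] exI[of _ t]) (simp add: add.commute add.left_commute)
qed

text \<open>The second difference is symmetric in \<open>i\<close> and \<open>j\<close>. On squares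
  of side 1/(k+1) it equates the two mixed partials at two nearby, possibly different, points; both
  tend to \<open>x\<close>, and continuity gives equality there.\<close>

lemma partial_deriv_commute:
  fixes f :: "real^'n::finite \<Rightarrow> real"
  assumes f: "smooth_on UNIV f"
  shows "\<partial> i (\<partial> j f) x = \<partial> j (\<partial> i f) x"
proof -
  define r where "r k = inverse (real (Suc k))" for k
  have r: "r k > 0" for k by (simp add: r_def)
  have "\<forall>k. \<exists>s t s' t'. (0 < s \<and> s < r k) \<and> (0 < t \<and> t < r k) \<and> (0 < s' \<and> s' < r k) \<and> (0 < t' \<and> t' < r k) \<and>
    \<partial> j (\<partial> i f) (x + s *\<^sub>R axis i 1 + t *\<^sub>R axis j 1) = \<partial> i (\<partial> j f) (x + s' *\<^sub>R axis j 1 + t' *\<^sub>R axis i 1)"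
  proof
    fix k
    obtain s t s' t' where 1: "0 < s" "s < r k" "0 < t" "t < r k"
      "f (x + r k *\<^sub>R axis i 1 + r k *\<^sub>R axis j 1) - f (x + r k *\<^sub>R axis i 1) - f (x + r k *\<^sub>R axis j 1) + f x
        = r k * r k * \<partial> j (\<partial> i f) (x + s *\<^sub>R axis i 1 + t *\<^sub>R axis j 1)"
     and 2: "0 < s'" "s' < r k" "0 < t'" "t' < r k"
      "f (x + r k *\<^sub>R axis j 1 + r k *\<^sub>R axis i 1) - f (x + r k *\<^sub>R axis j 1) - f (x + r k *\<^sub>R axis i 1) + f x
        = r k * r k * \<partial> i (\<partial> j f) (x + s' *\<^sub>R axis j 1 + t' *\<^sub>R axis i 1)"
      using second_difference_mean_value[OF f r, of k x i j] second_difference_mean_value[OF f r, of k x j i]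
      by blast
    have swap: "x + r k *\<^sub>R axis i 1 + r k *\<^sub>R axis j (1::real) = x + r k *\<^sub>R axis j 1 + r k *\<^sub>R axis i 1"
      by simp
    have "r k * r k * \<partial> j (\<partial> i f) (x + s *\<^sub>R axis i 1 + t *\<^sub>R axis j 1)
        = r k * r k * \<partial> i (\<partial> j f) (x + s' *\<^sub>R axis j 1 + t' *\<^sub>R axis i 1)"
      using 1(5) 2(5) unfolding swap by linarith
    then have "\<partial> j (\<partial> i f) (x + s *\<^sub>R axis i 1 + t *\<^sub>R axis j 1) = \<partial> i (\<partial> j f) (x + s' *\<^sub>R axis j 1 + t' *\<^sub>R axis i 1)"
      using r[of k] by simp
    then show "\<exists>s t s' t'. (0 < s \<and> s < r k) \<and> (0 < t \<and> t < r k) \<and> (0 < s' \<and> s' < r k) \<and> (0 < t' \<and> t' < r k) \<and>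
    \<partial> j (\<partial> i f) (x + s *\<^sub>R axis i 1 + t *\<^sub>R axis j 1) = \<partial> i (\<partial> j f) (x + s' *\<^sub>R axis j 1 + t' *\<^sub>R axis i 1)"
      using 1 2 by blast
  qed
  then obtain s t s' t' where st: "\<And>k. 0 < s k \<and> s k < r k" "\<And>k. 0 < t k \<and> t k < r k"
      "\<And>k. 0 < s' k \<and> s' k < r k" "\<And>k. 0 < t' k \<and> t' k < r k"
    and eq: "\<And>k. \<partial> j (\<partial> i f) (x + s k *\<^sub>R axis i 1 + t k *\<^sub>R axis j 1)
      = \<partial> i (\<partial> j f) (x + s' k *\<^sub>R axis j 1 + t' k *\<^sub>R axis i 1)"
    by metis
  have r0: "r \<longlonglongrightarrow> 0"
    unfolding r_def by (rule LIMSEQ_inverse_real_of_nat)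
  have z: "a \<longlonglongrightarrow> 0" if "\<And>k. 0 < a k \<and> a k < r k" for a
    by (rule tendsto_sandwich[OF _ _ tendsto_const r0]) (auto intro!: always_eventually less_imp_le that[THEN conjunct1] that[THEN conjunct2])
  have lim: "(\<lambda>k. \<partial> a (\<partial> b f) (x + u k *\<^sub>R axis b 1 + v k *\<^sub>R axis a 1)) \<longlonglongrightarrow> \<partial> a (\<partial> b f) x"
    if "u \<longlonglongrightarrow> 0" "v \<longlonglongrightarrow> 0" for a b u v
  proof -
    have "(\<lambda>k. x + u k *\<^sub>R axis b (1::real) + v k *\<^sub>R axis a 1) \<longlonglongrightarrow> x + 0 *\<^sub>R axis b 1 + 0 *\<^sub>R axis a 1"
      by (intro tendsto_intros that)
    moreover have "isCont (\<partial> a (\<partial> b f)) x"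
      using smooth_on_UNIV_D(3)[OF smooth_on_UNIV_D(1)[OF smooth_on_UNIV_D(1)[OF f]]]
      by (simp add: continuous_on_eq_continuous_at)
    ultimately show ?thesis
      using isCont_tendsto_compose[of x "\<partial> a (\<partial> b f)"] by simp
  qed
  show ?thesis
    by (rule LIMSEQ_unique[OF lim[OF z[OF st(3)] z[OF st(4)]]])
       (use lim[OF z[OF st(1)] z[OF st(2)], where a = j and b = i] in \<open>simp add: eq\<close>)
qed


section \<open>Warped products in product charts\<close>

lemma sum_UNIV_sum:
  "(\<Sum>s\<in>(UNIV :: ('n::finite + 'm::finite) set). g s) = (\<Sum>i\<in>UNIV. g (Inl i)) + (\<Sum>a\<in>UNIV. g (Inr a))"
  using sum.Plus[of "UNIV :: 'n set" "UNIV :: 'm set" g] by simp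

lemma matrix_inv_inverse:
  fixes A :: "real^'n^'n::finite"
  assumes "invertible A"
  shows "A ** matrix_inv A = mat 1 \<and> matrix_inv A ** A = mat 1"
  using assms unfolding invertible_def matrix_inv_def by (rule someI_ex)

lemma matrix_inv_eqI:
  fixes A B :: "real^'n^'n::finite"
  assumes "A ** B = mat 1" "B ** A = mat 1"
  shows "matrix_inv A = B"
proof -
  have "invertible A"
    using assms by (auto simp: invertible_def)
  have "matrix_inv A = matrix_inv A ** (A ** B)"
    by (simp add: assms matrix_mul_rid)
  also have "\<dots> = B"
    using matrix_inv_inverse[OF \<open>invertible A\<close>] by (simp add: matrix_mul_assoc matrix_mul_lid)
  finally show ?thesis .
qed

lemma metric_inverse_sums:
  fixes A :: "real^'n^'n::finite"
  assumes "invertible A"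
  shows "(\<Sum>k\<in>UNIV. A $ i $ k * matrix_inv A $ k $ j) = (if i = j then 1 else 0)"
    and "(\<Sum>k\<in>UNIV. matrix_inv A $ i $ k * A $ k $ j) = (if i = j then 1 else 0)"
  using arg_cong[OF matrix_inv_inverse[OF assms, THEN conjunct1], of "\<lambda>M. M $ i $ j"]
    arg_cong[OF matrix_inv_inverse[OF assms, THEN conjunct2], of "\<lambda>M. M $ i $ j"]
  by (simp_all add: matrix_matrix_mult_def mat_def)

definition coord_gradient ::
    "('a, 'n::finite) metric_chart \<Rightarrow> ('a \<Rightarrow> real) \<Rightarrow> 'n \<Rightarrow> 'a \<Rightarrow> real"
  where "coord_gradient c u k p =
    (\<Sum>l\<in>UNIV. matrix_inv (chart_metric c p) $ k $ l * coord_deriv c l u p)"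

text \<open>The divergence of the gradient, with the connection trace Gamma^k_kt: the shape in which
  it drops out of the contracted curvature tensor.\<close>

definition coord_laplacian :: "('a, 'n::finite) metric_chart \<Rightarrow> ('a \<Rightarrow> real) \<Rightarrow> 'a \<Rightarrow> real"
  where "coord_laplacian c u p = (\<Sum>k\<in>UNIV. coord_deriv c k (coord_gradient c u k) p
    + (\<Sum>t\<in>UNIV. christoffel c k k t p * coord_gradient c u t p))"

text \<open>Kronecker deltas are moved outward through products and sums until the standard
  delta-sum rules apply; in the last equation the condition does not depend on the summation
  index.\<close>

lemma if_zero_simps:
  "(if P then x else 0) * y = (if P then x * y else (0::real))"
  "y * (if P then x else 0) = (if P then y * x else (0::real))"
  "- (if P then x else 0) = (if P then - x else (0::real))"
  "(\<Sum>i\<in>A. if P then g i else 0) = (if P then \<Sum>i\<in>A. g i else (0::real))"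
  by auto

lemma warped_metric [simp]:
  "chart_metric (warped_chart b f c) (p, q) $ Inl i $ Inl j = chart_metric b p $ i $ j"
  "chart_metric (warped_chart b f c) (p, q) $ Inl i $ Inr a = 0"
  "chart_metric (warped_chart b f c) (p, q) $ Inr a $ Inl i = 0"
  "chart_metric (warped_chart b f c) (p, q) $ Inr a $ Inr a' = (f p)\<^sup>2 * chart_metric c q $ a $ a'"
  by (simp_all add: warped_chart_def)

text \<open>The base stays abstract. Differentiability is assumed for what the product and quotient
  rules act on: the fibre metric, \<open>f\<close>, its first derivatives and its gradient.\<close>

locale warped_charts = base: regular_chart b + fibre: regular_chart c
  for b :: "('a, 'n::finite) metric_chart" and c :: "('b, 'm::finite) metric_chart" +
  fixes f :: "'a \<Rightarrow> real"
  assumes warp_nonzero: "p \<in> chart_dom b \<Longrightarrow> f p \<noteq> 0"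
    and base_invertible: "p \<in> chart_dom b \<Longrightarrow> invertible (chart_metric b p)"
    and fibre_invertible: "q \<in> chart_dom c \<Longrightarrow> invertible (chart_metric c q)"
    and fibre_symmetric: "q \<in> chart_dom c \<Longrightarrow> chart_metric c q $ a $ a' = chart_metric c q $ a' $ a"
    and fibre_metric_deriv: "q \<in> chart_dom c \<Longrightarrow>
      has_coord_deriv c d (\<lambda>q. chart_metric c q $ a $ a') (coord_deriv c d (\<lambda>q. chart_metric c q $ a $ a') q) q"
    and warp_deriv: "p \<in> chart_dom b \<Longrightarrow> has_coord_deriv b i f (coord_deriv b i f p) p"
    and warp_deriv2: "p \<in> chart_dom b \<Longrightarrow>
      has_coord_deriv b i (coord_deriv b j f) (coord_deriv b i (coord_deriv b j f) p) p"
    and gradient_deriv: "p \<in> chart_dom b \<Longrightarrow>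
      has_coord_deriv b i (coord_gradient b f k) (coord_deriv b i (coord_gradient b f k) p) p"
begin

abbreviation "w \<equiv> warped_chart b f c"

section \<open>Coordinate derivatives on the product chart\<close>

lemma chart_map_warped:
  "chart_map w (p, q) + t *\<^sub>R axis (Inl i) 1
    = (\<chi> s. case s of Inl i' \<Rightarrow> (chart_map b p + t *\<^sub>R axis i 1) $ i' | Inr a \<Rightarrow> chart_map c q $ a)"
  "chart_map w (p, q) + t *\<^sub>R axis (Inr a) 1
    = (\<chi> s. case s of Inl i' \<Rightarrow> chart_map b p $ i' | Inr a' \<Rightarrow> (chart_map c q + t *\<^sub>R axis a 1) $ a')"
  by (auto simp: warped_chart_def vec_eq_iff axis_def split: sum.splits)

lemma inj_warped: "inj_on (chart_map w) (chart_dom w)"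
proof (rule inj_onI)
  fix r r' assume r: "r \<in> chart_dom w" "r' \<in> chart_dom w" and eq: "chart_map w r = chart_map w r'"
  obtain p q p' q' where pq: "r = (p, q)" "r' = (p', q')"
    by fastforce
  have "chart_map w (p, q) $ s = chart_map w (p', q') $ s" for s
    using eq pq by simp
  from this[of "Inl _"] this[of "Inr _"]
  have "chart_map b p = chart_map b p'" "chart_map c q = chart_map c q'"
    by (auto simp: warped_chart_def vec_eq_iff)
  then show "r = r'"
    using r base.inj_chart fibre.inj_chart by (auto simp: pq warped_chart_def dest: inj_onD)
qed

lemma chart_inv_warped:
  assumes "y \<in> chart_map b ` chart_dom b" "z \<in> chart_map c ` chart_dom c"
  shows "chart_inv w (\<chi> s. case s of Inl i \<Rightarrow> y $ i | Inr a \<Rightarrow> z $ a) = (chart_inv b y, chart_inv c z)"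
  unfolding chart_inv_def[of w]
proof (rule inv_into_f_eq[OF inj_warped])
  show "(chart_inv b y, chart_inv c z) \<in> chart_dom w"
    using assms by (auto simp: warped_chart_def)
  show "chart_map w (chart_inv b y, chart_inv c z) = (\<chi> s. case s of Inl i \<Rightarrow> y $ i | Inr a \<Rightarrow> z $ a)"
    by (simp add: warped_chart_def base.map_chart_inv fibre.map_chart_inv assms)
qed

text \<open>Along a base coordinate curve the fibre point is frozen, and near parameter 0 the
  inverse of the product chart splits. The two functions of the parameter agree there, so the
  equation holds for arbitrary \<open>u\<close>.\<close>

lemma coord_deriv_Inl [simp]:
  assumes p: "p \<in> chart_dom b" and q: "q \<in> chart_dom c"
  shows "coord_deriv w (Inl i) u (p, q) = coord_deriv b i (\<lambda>p. u (p, q)) p"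
  unfolding coord_deriv_def partial_deriv_def o_def
  by (rule deriv_cong_ev[OF eventually_mono[OF base.eventually_curve_in_image[OF p, of i]]])
     (simp_all only: chart_map_warped chart_inv_warped imageI[OF q] fibre.chart_inv_map q)

lemma coord_deriv_Inr [simp]:
  assumes p: "p \<in> chart_dom b" and q: "q \<in> chart_dom c"
  shows "coord_deriv w (Inr a) u (p, q) = coord_deriv c a (\<lambda>q. u (p, q)) q"
  unfolding coord_deriv_def partial_deriv_def o_def
  by (rule deriv_cong_ev[OF eventually_mono[OF fibre.eventually_curve_in_image[OF q, of a]]])
     (simp_all only: chart_map_warped chart_inv_warped imageI[OF p] base.chart_inv_map p)

section \<open>Inverse metric and Christoffel symbols of the warped product\<close>

lemma warped_inverse:
  assumes p: "p \<in> chart_dom b" and q: "q \<in> chart_dom c"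
  shows "matrix_inv (chart_metric w (p, q)) = (\<chi> s t. case (s, t) of
      (Inl i, Inl j) \<Rightarrow> matrix_inv (chart_metric b p) $ i $ j
    | (Inr a, Inr a') \<Rightarrow> matrix_inv (chart_metric c q) $ a $ a' / (f p)\<^sup>2
    | _ \<Rightarrow> 0)" (is "_ = ?H")
proof (rule matrix_inv_eqI)
  note inv = metric_inverse_sums[OF base_invertible[OF p]] metric_inverse_sums[OF fibre_invertible[OF q]]
  have "(chart_metric w (p, q) ** ?H) $ s $ t = mat 1 $ s $ t" for s t
    by (cases s; cases t)
       (simp_all add: matrix_matrix_mult_def mat_def sum_UNIV_sum inv warp_nonzero[OF p])
  then show "chart_metric w (p, q) ** ?H = mat 1"
    by (simp add: vec_eq_iff)
  have "(?H ** chart_metric w (p, q)) $ s $ t = mat 1 $ s $ t" for s t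
    by (cases s; cases t)
       (simp_all add: matrix_matrix_mult_def mat_def sum_UNIV_sum inv warp_nonzero[OF p])
  then show "?H ** chart_metric w (p, q) = mat 1"
    by (simp add: vec_eq_iff)
qed

lemma fibre_inverse_sum:
  "q \<in> chart_dom c \<Longrightarrow>
    (\<Sum>d\<in>UNIV. matrix_inv (chart_metric c q) $ a $ d * chart_metric c q $ a' $ d) = (if a = a' then 1 else 0)"
  using metric_inverse_sums(2)[OF fibre_invertible, of q a a'] by (simp add: fibre_symmetric[of q a'])

lemma coord_deriv_warp_square:
  assumes "p \<in> chart_dom b"
  shows "coord_deriv b i (\<lambda>p. (f p)\<^sup>2 * k) p = 2 * f p * coord_deriv b i f p * k"
  using base.has_coord_deriv_cmult[OF base.has_coord_deriv_mult[OF warp_deriv[OF assms] warp_deriv[OF assms] assms], of i k]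
  by (simp add: has_coord_deriv_imp_eq power2_eq_square algebra_simps)

lemma coord_deriv_fibre_metric:
  assumes "q \<in> chart_dom c"
  shows "coord_deriv c d (\<lambda>q. k * chart_metric c q $ a $ a') q
    = k * coord_deriv c d (\<lambda>q. chart_metric c q $ a $ a') q"
  by (rule has_coord_deriv_imp_eq[OF fibre.has_coord_deriv_cmult[OF fibre_metric_deriv[OF assms]]])

lemmas christoffel_simps = christoffel_def sum_UNIV_sum warped_inverse coord_deriv_warp_square
  coord_deriv_fibre_metric

text \<open>The metric is block diagonal, its base block depends on \<open>p\<close> alone, and the
  fibre block depends on \<open>p\<close> only through \<open>f\<close>. So with two fibre indices
  and one base index only a derivative of \<open>f^2\<close> survives; with three fibre indices
  \<open>f^2\<close> cancels against the inverse metric.\<close>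

lemma warped_christoffel:
  assumes p: "p \<in> chart_dom b" and q: "q \<in> chart_dom c"
  shows "christoffel w (Inl k) (Inl i) (Inl j) (p, q) = christoffel b k i j p"
    and "christoffel w (Inl k) (Inl i) (Inr a) (p, q) = 0"
    and "christoffel w (Inl k) (Inr a) (Inl i) (p, q) = 0"
    and "christoffel w (Inl k) (Inr a) (Inr a') (p, q) = - f p * coord_gradient b f k p * chart_metric c q $ a $ a'"
    and "christoffel w (Inr d) (Inl i) (Inl j) (p, q) = 0"
    and "christoffel w (Inr d) (Inl i) (Inr a) (p, q) = (if d = a then coord_deriv b i f p / f p else 0)"
    and "christoffel w (Inr d) (Inr a) (Inl i) (p, q) = (if d = a then coord_deriv b i f p / f p else 0)"
    and "christoffel w (Inr d) (Inr a) (Inr a') (p, q) = christoffel c d a a' q"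
proof -
  note [simp] = p q warp_nonzero[OF p]
  \<comment> \<open>The one surviving term of the two symbols with upper fibre index and one lower
    base index; the inverse fibre metric contracts it to a Kronecker delta.\<close>
  have RLR: "(1/2) * (\<Sum>l\<in>UNIV. matrix_inv (chart_metric c q) $ d $ l / (f p)\<^sup>2 *
      (2 * f p * coord_deriv b i f p * chart_metric c q $ a $ l)) = (if d = a then coord_deriv b i f p / f p else 0)"
    for d a i
  proof -
    have "(1/2) * (\<Sum>l\<in>UNIV. matrix_inv (chart_metric c q) $ d $ l / (f p)\<^sup>2 *
      (2 * f p * coord_deriv b i f p * chart_metric c q $ a $ l))
      = coord_deriv b i f p / f p * (\<Sum>l\<in>UNIV. matrix_inv (chart_metric c q) $ d $ l * chart_metric c q $ a $ l)"
      unfolding sum_distrib_left by (rule sum.cong) (simp_all add: power2_eq_square field_simps)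
    then show ?thesis
      by (simp add: fibre_inverse_sum)
  qed
  show "christoffel w (Inl k) (Inl i) (Inl j) (p, q) = christoffel b k i j p"
    and "christoffel w (Inl k) (Inl i) (Inr a) (p, q) = 0"
    and "christoffel w (Inl k) (Inr a) (Inl i) (p, q) = 0"
    and "christoffel w (Inr d) (Inl i) (Inl j) (p, q) = 0"
    by (simp_all add: christoffel_simps)
  show "christoffel w (Inr d) (Inl i) (Inr a) (p, q) = (if d = a then coord_deriv b i f p / f p else 0)"
    and "christoffel w (Inr d) (Inr a) (Inl i) (p, q) = (if d = a then coord_deriv b i f p / f p else 0)"
    using RLR by (simp_all add: christoffel_simps)
  show "christoffel w (Inl k) (Inr a) (Inr a') (p, q) = - f p * coord_gradient b f k p * chart_metric c q $ a $ a'"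
    by (simp add: christoffel_simps coord_gradient_def sum_distrib_left sum_distrib_right sum_negf ac_simps)
  show "christoffel w (Inr d) (Inr a) (Inr a') (p, q) = christoffel c d a a' q"
    by (simp add: christoffel_simps distrib_left[symmetric] right_diff_distrib[symmetric])
qed

end


section \<open>Ricci curvature and Hessian of the warped product\<close>

context warped_charts
begin

lemma coord_deriv_log_warp:
  assumes p: "p \<in> chart_dom b"
  shows "coord_deriv b i (\<lambda>p. coord_deriv b j f p / f p) p
    = coord_deriv b i (coord_deriv b j f) p / f p - coord_deriv b i f p * coord_deriv b j f p / (f p)\<^sup>2"
proof -
  have "coord_deriv b i (\<lambda>p. coord_deriv b j f p / f p) p
    = (coord_deriv b i (coord_deriv b j f) p * f p - coord_deriv b j f p * coord_deriv b i f p) / (f p * f p)"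
    by (rule has_coord_deriv_imp_eq[OF base.has_coord_deriv_divide[OF warp_deriv2[OF p] warp_deriv[OF p] p warp_nonzero[OF p]]])
  then show ?thesis
    using warp_nonzero[OF p] by (simp add: field_simps power2_eq_square)
qed

lemma coord_deriv_warp_gradient:
  assumes p: "p \<in> chart_dom b"
  shows "coord_deriv b i (\<lambda>p. - f p * coord_gradient b f k p * g) p
    = - (coord_deriv b i f p * coord_gradient b f k p + f p * coord_deriv b i (coord_gradient b f k) p) * g"
proof -
  have "has_coord_deriv b i (\<lambda>p. - g * (f p * coord_gradient b f k p))
    (- g * (coord_deriv b i f p * coord_gradient b f k p + coord_deriv b i (coord_gradient b f k) p * f p)) p"
    by (intro base.has_coord_deriv_cmult base.has_coord_deriv_mult warp_deriv gradient_deriv p)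
  then show ?thesis
    using has_coord_deriv_imp_eq by (fastforce simp: algebra_simps)
qed

text \<open>For fixed \<open>q\<close> the formulas for the symbols hold on the whole base domain,
  so they can be inserted under the derivative. The Ricci contraction meets Gamma^d_aj under a base
  derivative only in the traced form d = a.\<close>

lemma base_deriv_christoffel:
  assumes p: "p \<in> chart_dom b" and q: "q \<in> chart_dom c"
  shows "coord_deriv b l (\<lambda>p. christoffel w (Inl k) (Inl i) (Inl j) (p, q)) p = coord_deriv b l (christoffel b k i j) p"
    and "coord_deriv b l (\<lambda>p. christoffel w (Inl k) (Inl i) (Inr a) (p, q)) p = 0"
    and "coord_deriv b l (\<lambda>p. christoffel w (Inl k) (Inr a) (Inl i) (p, q)) p = 0"
    and "coord_deriv b l (\<lambda>p. christoffel w (Inl k) (Inr a) (Inr a') (p, q)) p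
      = - (coord_deriv b l f p * coord_gradient b f k p + f p * coord_deriv b l (coord_gradient b f k) p)
        * chart_metric c q $ a $ a'"
    and "coord_deriv b l (\<lambda>p. christoffel w (Inr d) (Inr d) (Inl j) (p, q)) p
      = coord_deriv b l (coord_deriv b j f) p / f p - coord_deriv b l f p * coord_deriv b j f p / (f p)\<^sup>2"
    and "coord_deriv b l (\<lambda>p. christoffel w (Inr d) (Inr a) (Inr a') (p, q)) p = 0"
  \<comment> \<open>The case with two lower fibre indices is taken first, since it needs the product
    rule for \<open>f\<close> times its gradient; the others are a congruence and a
    simplification.\<close>
  prefer 4
  apply (rule trans[OF base.coord_deriv_cong[OF p warped_christoffel(4)[OF _ q]] coord_deriv_warp_gradient[OF p]], assumption)
  by (subst base.coord_deriv_cong[OF p warped_christoffel(1)[OF _ q]]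
        base.coord_deriv_cong[OF p warped_christoffel(2)[OF _ q]]
        base.coord_deriv_cong[OF p warped_christoffel(3)[OF _ q]]
        base.coord_deriv_cong[OF p warped_christoffel(7)[OF _ q]]
        base.coord_deriv_cong[OF p warped_christoffel(8)[OF _ q]], assumption,
      simp add: coord_deriv_log_warp[OF p])+

lemma fibre_deriv_christoffel:
  assumes p: "p \<in> chart_dom b" and q: "q \<in> chart_dom c"
  shows "coord_deriv c l (\<lambda>q. christoffel w (Inl k) (Inl i) (Inl j) (p, q)) q = 0"
    and "coord_deriv c l (\<lambda>q. christoffel w (Inl k) (Inl i) (Inr a) (p, q)) q = 0"
    and "coord_deriv c l (\<lambda>q. christoffel w (Inl k) (Inr a) (Inl i) (p, q)) q = 0"
    and "coord_deriv c l (\<lambda>q. christoffel w (Inr d) (Inl i) (Inl j) (p, q)) q = 0"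
    and "coord_deriv c l (\<lambda>q. christoffel w (Inr d) (Inl i) (Inr a) (p, q)) q = 0"
    and "coord_deriv c l (\<lambda>q. christoffel w (Inr d) (Inr a) (Inl i) (p, q)) q = 0"
    and "coord_deriv c l (\<lambda>q. christoffel w (Inr d) (Inr a) (Inr a') (p, q)) q
      = coord_deriv c l (christoffel c d a a') q"
  by (subst fibre.coord_deriv_cong[OF q warped_christoffel(1)[OF p]]
        fibre.coord_deriv_cong[OF q warped_christoffel(2)[OF p]]
        fibre.coord_deriv_cong[OF q warped_christoffel(3)[OF p]]
        fibre.coord_deriv_cong[OF q warped_christoffel(5)[OF p]]
        fibre.coord_deriv_cong[OF q warped_christoffel(6)[OF p]]
        fibre.coord_deriv_cong[OF q warped_christoffel(7)[OF p]]
        fibre.coord_deriv_cong[OF q warped_christoffel(8)[OF p]], assumption, simp)+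

lemma fibre_christoffel_commute:
  assumes "q \<in> chart_dom c"
  shows "christoffel c d a a' q = christoffel c d a' a q"
proof -
  have "coord_deriv c l (\<lambda>q. chart_metric c q $ a $ a') q = coord_deriv c l (\<lambda>q. chart_metric c q $ a' $ a) q" for l
    by (rule fibre.coord_deriv_cong[OF assms fibre_symmetric])
  then show ?thesis
    by (simp add: christoffel_def ac_simps)
qed

lemmas ricci_simps = ricci_def riemann_def sum_UNIV_sum warped_christoffel base_deriv_christoffel
  fibre_deriv_christoffel if_zero_simps sum.distrib sum_subtractf

text \<open>Base summation indices give the Ricci tensor of the base. Each of the
  \<open>CARD('m)\<close> fibre indices adds minus the Hessian of \<open>f\<close> over
  \<open>f\<close>: the quadratic term from differentiating f_j / f cancels against Gamma^d_id
  Gamma^d_dj.\<close>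

lemma warped_ricci_base:
  assumes p: "p \<in> chart_dom b" and q: "q \<in> chart_dom c"
  shows "ricci w (Inl i) (Inl j) (p, q)
    = ricci b i j p - real CARD('m) / f p * hessian b f i j p"
proof -
  note [simp] = p q warp_nonzero[OF p]
  have "(\<Sum>k\<in>UNIV. coord_deriv b k f p * christoffel b k i j p / f p)
      = (\<Sum>k\<in>UNIV. christoffel b k i j p * coord_deriv b k f p) / f p"
    by (simp add: sum_divide_distrib ac_simps)
  then show ?thesis
    by (simp add: ricci_simps hessian_def power2_eq_square field_simps)
qed

text \<open>All that survives is Gamma^d_da f_i / f, once with each sign. In the second order of
  arguments the lower indices of one copy are exchanged, whence the symmetry of the fibre
  symbols.\<close>

lemma warped_ricci_mixed:
  assumes p: "p \<in> chart_dom b" and q: "q \<in> chart_dom c"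
  shows "ricci w (Inl i) (Inr a) (p, q) = 0" "ricci w (Inr a) (Inl i) (p, q) = 0"
proof -
  note [simp] = p q warp_nonzero[OF p]
  show "ricci w (Inl i) (Inr a) (p, q) = 0"
    by (simp add: ricci_simps ac_simps)
  show "ricci w (Inr a) (Inl i) (p, q) = 0"
    by (simp add: ricci_simps fibre_christoffel_commute[of q _ a] ac_simps)
qed

text \<open>Base summation indices give -f times the Laplacian, their two squared gradients
  cancelling. Fibre indices give the fibre Ricci tensor, m squared gradients with negative sign from
  Gamma^d_dj Gamma^j_aa' and one with positive sign from Gamma^d_aj Gamma^j_da'; hence the factor m
  - 1.\<close>

lemma warped_ricci_fibre:
  assumes p: "p \<in> chart_dom b" and q: "q \<in> chart_dom c"
  shows "ricci w (Inr a) (Inr a') (p, q) = ricci c a a' q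
    - (f p * coord_laplacian b f p
       + (real CARD('m) - 1) * (\<Sum>k\<in>UNIV. coord_deriv b k f p * coord_gradient b f k p)) * chart_metric c q $ a $ a'"
proof -
  note [simp] = p q warp_nonzero[OF p]
  show ?thesis
    by (simp add: ricci_simps coord_laplacian_def)
       (simp add: sum_distrib_left sum_distrib_right sum_negf sum_subtractf sum.distrib algebra_simps)
qed

lemma warped_hessian:
  assumes p: "p \<in> chart_dom b" and q: "q \<in> chart_dom c"
  shows "hessian w (\<lambda>(p, q). u p) (Inl i) (Inl j) (p, q) = hessian b u i j p"
    and "hessian w (\<lambda>(p, q). u p) (Inl i) (Inr a) (p, q) = 0"
    and "hessian w (\<lambda>(p, q). u p) (Inr a) (Inl i) (p, q) = 0"
    and "hessian w (\<lambda>(p, q). u p) (Inr a) (Inr a') (p, q)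
      = f p * (\<Sum>k\<in>UNIV. coord_gradient b f k p * coord_deriv b k u p) * chart_metric c q $ a $ a'"
proof -
  note [simp] = p q
  \<comment> \<open>The inner derivative must be known on the whole chart domain before the outer
    one is taken, so it is replaced by congruence.\<close>
  have [simp]: "coord_deriv b i (\<lambda>p. coord_deriv w (Inl j) (\<lambda>(p, q). u p) (p, q)) p = coord_deriv b i (coord_deriv b j u) p"
    "coord_deriv b i (\<lambda>p. coord_deriv w (Inr a) (\<lambda>(p, q). u p) (p, q)) p = 0" for i j a
    by (subst base.coord_deriv_cong[OF p coord_deriv_Inl[OF _ q]] base.coord_deriv_cong[OF p coord_deriv_Inr[OF _ q]], assumption, simp)+
  have [simp]: "coord_deriv c a (\<lambda>q. coord_deriv w (Inl j) (\<lambda>(p, q). u p) (p, q)) q = 0"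
    "coord_deriv c a (\<lambda>q. coord_deriv w (Inr a') (\<lambda>(p, q). u p) (p, q)) q = 0" for j a a'
    by (subst fibre.coord_deriv_cong[OF q coord_deriv_Inl[OF p]] fibre.coord_deriv_cong[OF q coord_deriv_Inr[OF p]], assumption, simp)+
  show "hessian w (\<lambda>(p, q). u p) (Inl i) (Inl j) (p, q) = hessian b u i j p"
    and "hessian w (\<lambda>(p, q). u p) (Inl i) (Inr a) (p, q) = 0"
    and "hessian w (\<lambda>(p, q). u p) (Inr a) (Inl i) (p, q) = 0"
    by (simp_all add: hessian_def sum_UNIV_sum warped_christoffel)
  show "hessian w (\<lambda>(p, q). u p) (Inr a) (Inr a') (p, q)
      = f p * (\<Sum>k\<in>UNIV. coord_gradient b f k p * coord_deriv b k u p) * chart_metric c q $ a $ a'"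
    by (simp add: hessian_def sum_UNIV_sum warped_christoffel sum_distrib_left sum_distrib_right sum_negf ac_simps)
qed

end


section \<open>Conformally flat metrics on a pseudo-Euclidean space\<close>

lemma has_coord_derivI:
  assumes "(u \<circ> chart_inv c) differentiable at (chart_map c p)"
  shows "has_coord_deriv c i u (coord_deriv c i u p) p"
  using has_partial_deriv[of "u \<circ> chart_inv c" "chart_map c p" 0 i] assms
  by (simp add: has_coord_deriv_def coord_deriv_def o_def)

text \<open>The Ricci contraction as pure algebra: with u_i = \<phi>_i / \<phi> and U_li the
  derivative of u_i along l, \<open>A\<close> is the Christoffel symbol of the conformal metric and
  \<open>dA\<close> its derivative. The sum falls apart into traces and single contractions.\<close>

lemma conformal_ricci_sum:
  fixes \<epsilon> u :: "'n::finite \<Rightarrow> real" and U :: "'n \<Rightarrow> 'n \<Rightarrow> real"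
  assumes \<epsilon>: "\<And>i. \<epsilon> i * \<epsilon> i = 1" and U: "U i j = U j i"
  defines "A \<equiv> \<lambda>k i j. - ((if k = i then u j else 0) + (if k = j then u i else 0) - (if i = j then \<epsilon> i * \<epsilon> k * u k else 0))"
    and "dA \<equiv> \<lambda>l k i j. - ((if k = i then U l j else 0) + (if k = j then U l i else 0) - (if i = j then \<epsilon> i * \<epsilon> k * U l k else 0))"
  shows "(\<Sum>s\<in>UNIV. dA s s i j - dA i s s j + (\<Sum>t\<in>UNIV. A s s t * A t i j - A s i t * A t s j))
    = (real CARD('n) - 2) * (U i j + u i * u j)
      + (if i = j then \<epsilon> i * (\<Sum>k\<in>UNIV. \<epsilon> k * (U k k - (real CARD('n) - 2) * (u k)\<^sup>2)) else 0)"
proof -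
  have \<epsilon>': "\<epsilon> i * (\<epsilon> i * a) = a" for i a
    using \<epsilon> by (simp add: mult.assoc[symmetric])
  then have \<epsilon>'': "\<epsilon> i * (a * (\<epsilon> i * a')) = a * a'" for i a a'
    by (simp add: mult.left_commute)
  \<comment> \<open>\<open>A s i\<close> acts on a vector \<open>v\<close> through one inner product
    and two rank-one terms; this evaluates the quadratic terms below.\<close>
  have contract: "(\<Sum>t\<in>UNIV. A s i t * v t)
      = - ((if s = i then \<Sum>t\<in>UNIV. u t * v t else 0) + u i * v s - \<epsilon> i * \<epsilon> s * u s * v i)" for s i v
    by (simp add: A_def if_zero_simps algebra_simps sum.distrib sum_subtractf sum_negf)
  have trace: "(\<Sum>s\<in>UNIV. A s s t) = - real CARD('n) * u t" for t
    by (simp add: A_def sum.distrib sum_subtractf sum_negf \<epsilon>)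
  have dtrace: "(\<Sum>s\<in>UNIV. dA i s s t) = - real CARD('n) * U i t" for t
    by (simp add: dA_def sum.distrib sum_subtractf sum_negf \<epsilon>)
  \<comment> \<open>The two delta terms give U_ij and U_ji, which the symmetry of \<open>U\<close>
    merges.\<close>
  have div: "(\<Sum>s\<in>UNIV. dA s s i j) = - 2 * U i j + (if i = j then \<epsilon> i * (\<Sum>k\<in>UNIV. \<epsilon> k * U k k) else 0)"
    by (simp add: dA_def sum.distrib sum_subtractf sum_negf U sum_distrib_left mult.assoc)
  have contract_u: "(\<Sum>t\<in>UNIV. u t * A t i j) = - 2 * u i * u j + (if i = j then \<epsilon> i * (\<Sum>k\<in>UNIV. \<epsilon> k * (u k)\<^sup>2) else 0)" for i j
    by (simp add: A_def if_zero_simps algebra_simps sum.distrib sum_subtractf sum_negf sum_distrib_left power2_eq_square)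
  have "(\<Sum>s\<in>UNIV. \<Sum>t\<in>UNIV. A s s t * A t i j) = (\<Sum>t\<in>UNIV. (\<Sum>s\<in>UNIV. A s s t) * A t i j)"
    by (subst sum.swap) (simp add: sum_distrib_right)
  also have "\<dots> = - real CARD('n) * (\<Sum>t\<in>UNIV. u t * A t i j)"
    by (simp add: trace sum_distrib_left mult.assoc sum_negf)
  finally have first: "(\<Sum>s\<in>UNIV. \<Sum>t\<in>UNIV. A s s t * A t i j)
      = real CARD('n) * (2 * u i * u j - (if i = j then \<epsilon> i * (\<Sum>k\<in>UNIV. \<epsilon> k * (u k)\<^sup>2) else 0))"
    by (simp add: contract_u algebra_simps)
  have "(\<Sum>s\<in>UNIV. \<Sum>t\<in>UNIV. A s i t * A t s j)
      = (\<Sum>s\<in>UNIV. - ((if s = i then \<Sum>t\<in>UNIV. u t * A t s j else 0) + u i * A s s j - \<epsilon> i * \<epsilon> s * u s * A i s j))"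
    by (simp add: contract)
  also have "\<dots> = - ((\<Sum>t\<in>UNIV. u t * A t i j) + u i * (\<Sum>s\<in>UNIV. A s s j) - \<epsilon> i * (\<Sum>s\<in>UNIV. \<epsilon> s * u s * A i s j))"
    by (simp add: sum.distrib sum_subtractf sum_negf sum_distrib_left mult.assoc)
  also have "(\<Sum>s\<in>UNIV. \<epsilon> s * u s * A i s j) = - (if i = j then \<Sum>k\<in>UNIV. \<epsilon> k * (u k)\<^sup>2 else 0)"
    by (simp add: A_def if_zero_simps algebra_simps sum.distrib sum_subtractf sum_negf power2_eq_square \<epsilon> \<epsilon>'')
  finally have second: "(\<Sum>s\<in>UNIV. \<Sum>t\<in>UNIV. A s i t * A t s j)
      = (real CARD('n) + 2) * u i * u j - 2 * (if i = j then \<epsilon> i * (\<Sum>k\<in>UNIV. \<epsilon> k * (u k)\<^sup>2) else 0)"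
    by (cases "i = j") (simp_all add: contract_u trace algebra_simps)
  have "(\<Sum>k\<in>UNIV. \<epsilon> k * (U k k - (real CARD('n) - 2) * (u k)\<^sup>2))
    = (\<Sum>k\<in>UNIV. \<epsilon> k * U k k) - (real CARD('n) - 2) * (\<Sum>k\<in>UNIV. \<epsilon> k * (u k)\<^sup>2)"
    by (simp add: algebra_simps sum_subtractf sum.distrib sum_distrib_left)
  note split_sum = this
  show ?thesis
    by (simp add: split_sum sum.distrib sum_subtractf first second div dtrace) (simp add: algebra_simps)
qed

definition conformal_chart :: "('n::finite \<Rightarrow> real) \<Rightarrow> (real^'n \<Rightarrow> real) \<Rightarrow> (real^'n, 'n) metric_chart"
  where "conformal_chart \<epsilon> \<phi> = \<lparr>chart_dom = UNIV, chart_map = (\<lambda>x. x),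
    chart_metric = (\<lambda>x. (1 / (\<phi> x)\<^sup>2) *\<^sub>R (\<chi> i j. if i = j then \<epsilon> i else 0))\<rparr>"

lemma conformal_metric_pseudo_euclidean:
  "conformal_metric \<phi> (pseudo_euclidean \<epsilon>) = {conformal_chart \<epsilon> \<phi>}"
  by (simp add: conformal_metric_def pseudo_euclidean_def conformal_chart_def)

text \<open>The sign condition is stated as \<epsilon>^2 = 1, the form in which the computations
  consume it.\<close>

locale conformally_flat =
  fixes \<epsilon> :: "'n::finite \<Rightarrow> real" and \<phi> :: "real^'n \<Rightarrow> real"
  assumes sign: "\<epsilon> i * \<epsilon> i = 1" and smooth_factor: "smooth_on UNIV \<phi>" and factor_nonzero: "\<phi> x \<noteq> 0"
begin

abbreviation "e \<equiv> conformal_chart \<epsilon> \<phi>"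

lemma conformal_chart_simps [simp]:
  "chart_dom e = UNIV" "chart_map e = (\<lambda>x. x)" "chart_inv e = (\<lambda>x. x)"
  "chart_metric e x $ i $ j = (if i = j then \<epsilon> i / (\<phi> x)\<^sup>2 else 0)"
  by (simp_all add: conformal_chart_def chart_inv_def inv_id[unfolded id_def])

sublocale regular_chart e
  by unfold_locales simp_all

lemma coord_deriv_conformal [simp]: "coord_deriv e = \<partial>"
  by (simp add: fun_eq_iff coord_deriv_def o_def)

lemma has_coord_deriv_smooth: "smooth_on UNIV u \<Longrightarrow> has_coord_deriv e i u (\<partial> i u x) x"
  using has_coord_derivI[of u e x i] smooth_on_UNIV_D(2)[of u] by (simp add: o_def differentiable_on_def)

section \<open>Connection and Ricci curvature of the conformally flat metric\<close>

lemma conformal_inverse: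
  "matrix_inv (chart_metric e x) = (\<chi> i j. if i = j then \<epsilon> i * (\<phi> x)\<^sup>2 else 0)"
  by (rule matrix_inv_eqI)
     (auto simp: vec_eq_iff matrix_matrix_mult_def mat_def if_zero_simps sign factor_nonzero)

lemma conformal_invertible: "invertible (chart_metric e x)"
  unfolding invertible_def
  by (rule exI[of _ "\<chi> i j. if i = j then \<epsilon> i * (\<phi> x)\<^sup>2 else 0"])
     (auto simp: vec_eq_iff matrix_matrix_mult_def mat_def if_zero_simps sign factor_nonzero)

lemma deriv_conformal_metric:
  "\<partial> l (\<lambda>x. if i = j then \<epsilon> i / (\<phi> x)\<^sup>2 else 0) x = (if i = j then - 2 * \<epsilon> i * \<partial> l \<phi> x / \<phi> x ^ 3 else 0)"
proof -
  have "has_coord_deriv e l (\<lambda>x. \<epsilon> i / (\<phi> x * \<phi> x))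
     ((0 * (\<phi> x * \<phi> x) - \<epsilon> i * (\<partial> l \<phi> x * \<phi> x + \<partial> l \<phi> x * \<phi> x)) / ((\<phi> x * \<phi> x) * (\<phi> x * \<phi> x))) x"
    by (intro has_coord_deriv_divide has_coord_deriv_const has_coord_deriv_mult has_coord_deriv_smooth smooth_factor)
       (auto simp: factor_nonzero)
  from has_coord_deriv_imp_eq[OF this] show ?thesis
    using coord_deriv_const[of l 0]
    by (cases "i = j") (simp_all add: power2_eq_square power3_eq_cube factor_nonzero field_simps)
qed

text \<open>The usual law for a conformal factor e^(2 psi) with psi = - log |\<phi>|, whose gradient
  is - \<phi>_i / \<phi>; the flat metric has constant coefficients and contributes no
  symbols.\<close>

lemma conformal_christoffel:
  "christoffel e k i j x = - ((if k = i then \<partial> j \<phi> x / \<phi> x else 0) + (if k = j then \<partial> i \<phi> x / \<phi> x else 0)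
    - (if i = j then \<epsilon> i * \<epsilon> k * (\<partial> k \<phi> x / \<phi> x) else 0))"
proof -
  have "\<epsilon> i * (\<epsilon> i * a) = a" for i a
    using sign by (simp add: mult.assoc[symmetric])
  then show ?thesis
    by (simp add: christoffel_def conformal_inverse deriv_conformal_metric if_zero_simps)
       (auto simp: factor_nonzero power2_eq_square power3_eq_cube field_simps sign)
qed

lemma has_coord_deriv_log_factor:
  "has_coord_deriv e l (\<lambda>x. \<partial> i \<phi> x / \<phi> x) (\<partial> l (\<partial> i \<phi>) x / \<phi> x - \<partial> l \<phi> x / \<phi> x * (\<partial> i \<phi> x / \<phi> x)) x"
proof -
  have "has_coord_deriv e l (\<lambda>x. \<partial> i \<phi> x / \<phi> x)
      ((\<partial> l (\<partial> i \<phi>) x * \<phi> x - \<partial> i \<phi> x * \<partial> l \<phi> x) / (\<phi> x * \<phi> x)) x"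
    by (intro has_coord_deriv_divide has_coord_deriv_smooth smooth_on_UNIV_D(1) smooth_factor)
       (auto simp: factor_nonzero)
  then show ?thesis
    by (simp add: factor_nonzero field_simps)
qed

lemma deriv_conformal_christoffel:
  defines "U \<equiv> \<lambda>l i x. \<partial> l (\<partial> i \<phi>) x / \<phi> x - \<partial> l \<phi> x / \<phi> x * (\<partial> i \<phi> x / \<phi> x)"
  shows "\<partial> l (christoffel e k i j) x = - ((if k = i then U l j x else 0) + (if k = j then U l i x else 0)
    - (if i = j then \<epsilon> i * \<epsilon> k * U l k x else 0))"
proof -
  \<comment> \<open>The conditions compare indices and do not vary with the point, so
    differentiation passes through the deltas.\<close>
  have if_deriv: "has_coord_deriv e l (\<lambda>x. if P then v x else 0) (if P then D else 0) x"
    if "has_coord_deriv e l v D x" for P v D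
    using that has_coord_deriv_const by (cases P) auto
  have "has_coord_deriv e l (christoffel e k i j) (- ((if k = i then U l j x else 0) + (if k = j then U l i x else 0)
    - (if i = j then \<epsilon> i * \<epsilon> k * U l k x else 0))) x"
    unfolding conformal_christoffel[abs_def] U_def
    by (intro has_coord_deriv_minus has_coord_deriv_add has_coord_deriv_diff has_coord_deriv_cmult if_deriv
        has_coord_deriv_log_factor)
  then show ?thesis
    by (auto dest: has_coord_deriv_imp_eq)
qed

lemma conformal_ricci:
  "ricci e i j x = (real CARD('n) - 2) * \<partial> i (\<partial> j \<phi>) x / \<phi> x
    + (if i = j then \<epsilon> i * (\<Sum>k\<in>UNIV. \<epsilon> k * (\<phi> x * \<partial> k (\<partial> k \<phi>) x - (real CARD('n) - 1) * (\<partial> k \<phi> x)\<^sup>2)) / (\<phi> x)\<^sup>2 else 0)"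
proof -
  define u where "u i = \<partial> i \<phi> x / \<phi> x" for i
  define U where "U l i = \<partial> l (\<partial> i \<phi>) x / \<phi> x - u l * u i" for l i
  have "U i j = U j i"
    by (simp add: U_def partial_deriv_commute[OF smooth_factor, of i j])
  from conformal_ricci_sum[where \<epsilon> = \<epsilon> and u = u and U = U, OF sign this]
  have "ricci e i j x = (real CARD('n) - 2) * (U i j + u i * u j)
      + (if i = j then \<epsilon> i * (\<Sum>k\<in>UNIV. \<epsilon> k * (U k k - (real CARD('n) - 2) * (u k)\<^sup>2)) else 0)"
    unfolding ricci_def riemann_def coord_deriv_conformal conformal_christoffel deriv_conformal_christoffel
      u_def U_def by simp
  \<comment> \<open>U_kk contains -u_k^2, which raises the coefficient n - 2 to n - 1; likewise U_ij
    + u_i u_j is just \<phi>_ij / \<phi>.\<close>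
  moreover have "(\<Sum>k\<in>UNIV. \<epsilon> k * (U k k - (real CARD('n) - 2) * (u k)\<^sup>2))
      = (\<Sum>k\<in>UNIV. \<epsilon> k * (\<phi> x * \<partial> k (\<partial> k \<phi>) x - (real CARD('n) - 1) * (\<partial> k \<phi> x)\<^sup>2)) / (\<phi> x)\<^sup>2"
    unfolding sum_divide_distrib
    by (rule sum.cong) (simp_all add: U_def u_def factor_nonzero field_simps power2_eq_square)
  ultimately show ?thesis
    by (simp add: U_def)
qed

section \<open>Hessian, gradient and Laplacian of the conformally flat metric\<close>

lemma conformal_hessian:
  "hessian e v i j x = \<partial> i (\<partial> j v) x + (\<partial> i \<phi> x * \<partial> j v x + \<partial> j \<phi> x * \<partial> i v x) / \<phi> x
    - (if i = j then \<epsilon> i * (\<Sum>k\<in>UNIV. \<epsilon> k * \<partial> k \<phi> x * \<partial> k v x) / \<phi> x else 0)"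
  by (simp add: hessian_def conformal_christoffel if_zero_simps algebra_simps sum.distrib sum_subtractf sum_negf
      sum_distrib_left sum_divide_distrib add_divide_distrib)

lemma conformal_gradient: "coord_gradient e v k x = \<epsilon> k * (\<phi> x)\<^sup>2 * \<partial> k v x"
  by (simp add: coord_gradient_def conformal_inverse if_zero_simps)

lemma has_coord_deriv_conformal_gradient:
  assumes "smooth_on UNIV v"
  shows "has_coord_deriv e l (coord_gradient e v k)
    (\<epsilon> k * (2 * \<phi> x * \<partial> l \<phi> x * \<partial> k v x + (\<phi> x)\<^sup>2 * \<partial> l (\<partial> k v) x)) x"
proof -
  have "has_coord_deriv e l (\<lambda>x. \<epsilon> k * ((\<phi> x * \<phi> x) * \<partial> k v x))
    (\<epsilon> k * ((\<partial> l \<phi> x * \<phi> x + \<partial> l \<phi> x * \<phi> x) * \<partial> k v x + \<partial> l (\<partial> k v) x * (\<phi> x * \<phi> x))) x"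
    by (intro has_coord_deriv_cmult has_coord_deriv_mult has_coord_deriv_smooth smooth_on_UNIV_D(1) smooth_factor assms)
       auto
  then show ?thesis
    by (simp add: conformal_gradient[abs_def] power2_eq_square algebra_simps)
qed

text \<open>The coefficient -(n - 2) combines 2 from differentiating \<phi>^2 in the gradient with
  -n from the traced Christoffel symbols.\<close>

lemma conformal_laplacian:
  assumes "smooth_on UNIV v"
  shows "coord_laplacian e v x = (\<Sum>k\<in>UNIV. \<epsilon> k * ((\<phi> x)\<^sup>2 * \<partial> k (\<partial> k v) x
    - (real CARD('n) - 2) * \<phi> x * \<partial> k \<phi> x * \<partial> k v x))"
proof -
  have deriv: "\<partial> l (coord_gradient e v k) x
      = \<epsilon> k * (2 * \<phi> x * \<partial> l \<phi> x * \<partial> k v x + (\<phi> x)\<^sup>2 * \<partial> l (\<partial> k v) x)" for l k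
    using has_coord_deriv_imp_eq[OF has_coord_deriv_conformal_gradient[OF assms]] by simp
  have trace: "(\<Sum>k\<in>UNIV. christoffel e k k t x) = - real CARD('n) * (\<partial> t \<phi> x / \<phi> x)" for t
    by (simp add: conformal_christoffel sum.distrib sum_subtractf sum_negf sign)
  have "(\<Sum>k\<in>UNIV. \<Sum>t\<in>UNIV. christoffel e k k t x * coord_gradient e v t x)
      = (\<Sum>t\<in>UNIV. (\<Sum>k\<in>UNIV. christoffel e k k t x) * coord_gradient e v t x)"
    by (subst sum.swap) (simp add: sum_distrib_right)
  then show ?thesis
    by (simp add: coord_laplacian_def sum.distrib deriv trace conformal_gradient factor_nonzero
        power2_eq_square sum_negf sum_subtractf sum_distrib_left sum_distrib_right algebra_simps)
qed

end


section \<open>The soliton equations\<close>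

lemma (in conformally_flat) warped_charts_conformal:
  assumes F: "semi_riemannian_manifold F" and c: "c \<in> F"
    and f: "smooth_on UNIV f" and f_nz: "\<And>x. f x \<noteq> 0"
  shows "warped_charts e c f"
proof -
  note F_def = F[unfolded semi_riemannian_manifold_def]
  note F_smooth = F_def[THEN conjunct2, THEN conjunct1]
  note F_metric = F_def[THEN conjunct2, THEN conjunct2, THEN conjunct1]
  from F_def[THEN conjunct1] have "\<forall>c\<in>F. open (chart_dom c) \<and> open (chart_map c ` chart_dom c) \<and>
       homeomorphism (chart_dom c) (chart_map c ` chart_dom c) (chart_map c) (chart_inv c)"
    unfolding smooth_atlas_def by (elim conjE)
  then have atlas: "open (chart_map c ` chart_dom c)"
      "homeomorphism (chart_dom c) (chart_map c ` chart_dom c) (chart_map c) (chart_inv c)"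
    using c by simp_all
  note smooth = bspec[OF F_smooth c, rule_format] and metric = bspec[OF F_metric c, rule_format]
  interpret fibre: regular_chart c
  proof
    show "inj_on (chart_map c) (chart_dom c)"
      by (rule inj_on_inverseI[where g = "chart_inv c"]) (rule homeomorphism_apply1[OF atlas(2)])
  qed (rule atlas(1))
  show ?thesis
  proof
    fix q a a' d assume q: "q \<in> chart_dom c"
    show "invertible (chart_metric c q)"
      using metric q by blast
    show "chart_metric c q $ a $ a' = chart_metric c q $ a' $ a"
      using arg_cong[OF metric[OF q, THEN conjunct1], of "\<lambda>M. M $ a $ a'"] by (simp add: transpose_def)
    \<comment> \<open>Level 1 of smoothness contains differentiability on the chart image, and
      openness turns this into differentiability at the point.\<close>
    have "Ck_on (Suc 0) (chart_map c ` chart_dom c) (\<lambda>x. chart_metric c (chart_inv c x) $ a $ a')"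
      using smooth unfolding smooth_on_def by blast
    then have "(\<lambda>x. chart_metric c (chart_inv c x) $ a $ a') differentiable at (chart_map c q)"
      using q atlas(1) by (auto simp: differentiable_on_eq_differentiable_at)
    then show "has_coord_deriv c d (\<lambda>q. chart_metric c q $ a $ a') (coord_deriv c d (\<lambda>q. chart_metric c q $ a $ a') q) q"
      by (intro has_coord_derivI) (simp add: o_def)
  next
    show "has_coord_deriv e i (coord_gradient e f k) (coord_deriv e i (coord_gradient e f k) x) x" for i k x
      unfolding has_coord_deriv_imp_eq[OF has_coord_deriv_conformal_gradient[OF f]]
      by (rule has_coord_deriv_conformal_gradient[OF f])
  qed (auto simp: f_nz conformal_invertible intro!: has_coord_deriv_smooth smooth_on_UNIV_D(1) f)
qed

lemma nonzero_multiple_iff: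
  fixes X Y :: real
  assumes "k \<noteq> 0" "k * (X - Y) = X' - Y'"
  shows "X = Y \<longleftrightarrow> X' = Y'"
  using assms by (metis eq_iff_diff_eq_0 mult_eq_0_iff)

lemma (in conformally_flat) warped_soliton_iff:
  assumes F: "semi_riemannian_manifold F" and ricci: "constant_ricci_curvature F \<Lambda>"
    and f: "smooth_on UNIV f" and f_nz: "\<And>x. f x \<noteq> 0"
  shows "gradient_ricci_soliton
      (warped_product {e} f (F :: ('q::{t2_space,second_countable_topology}, 'm::finite) metric_chart set))
      (\<lambda>(x, q). h x) \<rho> \<longleftrightarrow>
    (\<forall>x i j. ricci e i j x - real CARD('m) / f x * hessian e f i j x + hessian e h i j x
      = \<rho> * chart_metric e x $ i $ j) \<and>
    (\<forall>x. f x * coord_laplacian e f x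
      + (real CARD('m) - 1) * (\<Sum>k\<in>UNIV. \<partial> k f x * coord_gradient e f k x)
      - f x * (\<Sum>k\<in>UNIV. coord_gradient e f k x * \<partial> k h x) = \<Lambda> - \<rho> * (f x)\<^sup>2)"
    (is "?soliton \<longleftrightarrow> (\<forall>x i j. ?base x i j) \<and> (\<forall>x. ?L x = \<Lambda> - \<rho> * (f x)\<^sup>2)")
proof -
  have "warped_product {e} f F = warped_chart e f ` F"
    by (auto simp: warped_product_def)
  moreover have "chart_dom (warped_chart e f c) = UNIV \<times> chart_dom c" for c :: "('q, 'm) metric_chart"
    by (simp add: warped_chart_def)
  ultimately have "?soliton \<longleftrightarrow> (\<forall>c\<in>F. \<forall>x. \<forall>q\<in>chart_dom c. \<forall>s t.
      ricci (warped_chart e f c) s t (x, q) + hessian (warped_chart e f c) (\<lambda>(x, q). h x) s t (x, q)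
        = \<rho> * chart_metric (warped_chart e f c) (x, q) $ s $ t)"
    by (simp add: gradient_ricci_soliton_def split_paired_Ball_Sigma)
  also have "\<dots> \<longleftrightarrow> (\<forall>c\<in>F. \<forall>x. \<forall>q\<in>chart_dom c. (\<forall>i j. ?base x i j) \<and> ?L x = \<Lambda> - \<rho> * (f x)\<^sup>2)"
  proof (intro ball_cong all_cong1 refl)
    fix c x q assume c: "c \<in> F" and q: "q \<in> chart_dom c"
    interpret warped_charts e c f
      by (rule warped_charts_conformal[OF F c f f_nz])
    have x: "x \<in> chart_dom e" by simp
    \<comment> \<open>If all entries of the fibre metric vanished at \<open>q\<close>, so would a
      diagonal entry of its product with the inverse, which is 1. A nonzero entry lets the fibre
      equation be cancelled to a scalar one.\<close>
    obtain a a' where aa: "chart_metric c q $ a $ a' \<noteq> 0"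
      using metric_inverse_sums(1)[OF fibre_invertible[OF q], of undefined undefined]
      by (metis (no_types, lifting) mult_zero_left sum.neutral zero_neq_one)
    have L: "?L x = \<Lambda> - \<rho> * (f x)\<^sup>2 \<longleftrightarrow> (\<forall>a a'. \<Lambda> * chart_metric c q $ a $ a' - (f x * coord_laplacian e f x
        + (real CARD('m) - 1) * (\<Sum>k\<in>UNIV. \<partial> k f x * coord_gradient e f k x)) * chart_metric c q $ a $ a'
        + f x * (\<Sum>k\<in>UNIV. coord_gradient e f k x * \<partial> k h x) * chart_metric c q $ a $ a'
        = \<rho> * ((f x)\<^sup>2 * chart_metric c q $ a $ a'))" (is "_ \<longleftrightarrow> (\<forall>a a'. ?E a a')")
    proof -
      have "?E a a' \<longleftrightarrow> chart_metric c q $ a $ a' * (\<Lambda> - \<rho> * (f x)\<^sup>2 - ?L x) = 0" for a a'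
        by (simp add: algebra_simps)
      then show ?thesis
        using aa by auto
    qed
    have r: "ricci c a a' q = \<Lambda> * chart_metric c q $ a $ a'" for a a'
      using ricci c q by (simp add: constant_ricci_curvature_def)
    show "(\<forall>s t. ricci w s t (x, q) + hessian w (\<lambda>(x, q). h x) s t (x, q) = \<rho> * chart_metric w (x, q) $ s $ t)
        \<longleftrightarrow> (\<forall>i j. ?base x i j) \<and> ?L x = \<Lambda> - \<rho> * (f x)\<^sup>2"
      \<comment> \<open>Splitting both indices into base and fibre gives four blocks, the mixed ones
        trivial. The entries of \<open>chart_metric e\<close> stay folded to match the base
        equation.\<close>
      unfolding L
      by (simp add: split_sum_all warped_ricci_base[OF x q] warped_ricci_mixed[OF x q] warped_ricci_fibre[OF x q]
          warped_hessian[OF x q] r del: conformal_chart_simps(4))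
  qed
  also have "\<dots> \<longleftrightarrow> (\<forall>x i j. ?base x i j) \<and> (\<forall>x. ?L x = \<Lambda> - \<rho> * (f x)\<^sup>2)"
  proof -
    have "(\<Union>c\<in>F. chart_dom c) = UNIV"
      using F by (simp add: semi_riemannian_manifold_def smooth_atlas_def)
    then obtain c q where "c \<in> F" "q \<in> chart_dom c"
      by blast
    then show ?thesis
      by blast
  qed
  finally show ?thesis .
qed

theorem theorem1p2:
  fixes \<epsilon> :: "'n::finite \<Rightarrow> real"
    and f \<phi> h :: "real^'n \<Rightarrow> real"
    and F :: "('q::{t2_space,second_countable_topology}, 'm::finite) metric_chart set"
    and \<rho> \<Lambda> n m :: real
  assumes "n = real CARD('n)" and "m = real CARD('m)"
    and "CARD('n) \<ge> 3"
    and "\<forall>i. \<epsilon> i = 1 \<or> \<epsilon> i = -1"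
    and "smooth_on UNIV f" and "smooth_on UNIV \<phi>" and "smooth_on UNIV h"
    and "\<forall>x. f x > 0" and "\<forall>x. \<phi> x \<noteq> 0"
    and "semi_riemannian_manifold F" and "constant_ricci_curvature F \<Lambda>"
  shows "gradient_ricci_soliton
           (warped_product (conformal_metric \<phi> (pseudo_euclidean \<epsilon>)) f F) (\<lambda>(x, q). h x) \<rho>
    \<longleftrightarrow>
      (\<forall>x. \<forall>i j. i \<noteq> j \<longrightarrow>
         (n - 2) * f x * \<partial> j (\<partial> i \<phi>) x + f x * \<phi> x * \<partial> j (\<partial> i h) x
         - m * \<phi> x * \<partial> j (\<partial> i f) x - m * \<partial> i \<phi> x * \<partial> j f x - m * \<partial> j \<phi> x * \<partial> i f x
         + f x * \<partial> i \<phi> x * \<partial> j h x + f x * \<partial> j \<phi> x * \<partial> i h x = 0) \<and>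
      (\<forall>x. \<forall>i.
         \<phi> x * ((n - 2) * f x * \<partial> i (\<partial> i \<phi>) x + f x * \<phi> x * \<partial> i (\<partial> i h) x
           - m * \<phi> x * \<partial> i (\<partial> i f) x - 2 * m * \<partial> i \<phi> x * \<partial> i f x
           + 2 * f x * \<partial> i \<phi> x * \<partial> i h x)
         + \<epsilon> i * (\<Sum>k\<in>UNIV. \<epsilon> k * (f x * \<phi> x * \<partial> k (\<partial> k \<phi>) x
             - (n - 1) * f x * (\<partial> k \<phi> x)\<^sup>2 + m * \<phi> x * \<partial> k \<phi> x * \<partial> k f x
             - f x * \<phi> x * \<partial> k \<phi> x * \<partial> k h x))
         = \<epsilon> i * \<rho> * f x) \<and>
      (\<forall>x.
         (\<Sum>k\<in>UNIV. \<epsilon> k * (- f x * (\<phi> x)\<^sup>2 * \<partial> k (\<partial> k f) x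
             + (n - 2) * f x * \<phi> x * \<partial> k f x * \<partial> k \<phi> x
             - (m - 1) * (\<phi> x)\<^sup>2 * (\<partial> k f x)\<^sup>2
             + f x * (\<phi> x)\<^sup>2 * \<partial> k f x * \<partial> k h x))
         = \<rho> * (f x)\<^sup>2 - \<Lambda>)"
    (is "_ \<longleftrightarrow> (\<forall>x. \<forall>i j. i \<noteq> j \<longrightarrow> ?off x i j = 0) \<and> (\<forall>x. \<forall>i. ?diag x i = \<epsilon> i * \<rho> * f x)
      \<and> (\<forall>x. ?fib x = \<rho> * (f x)\<^sup>2 - \<Lambda>)")
proof -
  interpret conformally_flat \<epsilon> \<phi>
  proof
    show "\<epsilon> i * \<epsilon> i = 1" for i
      using assms(4)[rule_format, of i] by auto
  qed (use assms in auto)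
  have f: "f x \<noteq> 0" for x
    using assms(8)[rule_format, of x] by simp
  note nz = f factor_nonzero
  define B where "B x i j = ricci e i j x - m / f x * hessian e f i j x + hessian e h i j x" for x i j
  have off: "B x i j = \<rho> * chart_metric e x $ i $ j \<longleftrightarrow> ?off x i j = 0" if "i \<noteq> j" for x i j
  proof (rule nonzero_multiple_iff)
    \<comment> \<open>Off the diagonal the metric and the trace terms vanish, so f \<phi> clears
      every denominator.\<close>
    show "f x * \<phi> x \<noteq> 0"
      using nz by simp
    show "f x * \<phi> x * (B x i j - \<rho> * chart_metric e x $ i $ j) = ?off x i j - 0"
      using that nz unfolding B_def conformal_ricci conformal_hessian assms(1)
        partial_deriv_commute[OF assms(5), of i j] partial_deriv_commute[OF assms(6), of i j]
        partial_deriv_commute[OF assms(7), of i j]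
      by (simp add: field_simps)
  qed
  have diag: "B x i i = \<rho> * chart_metric e x $ i $ i \<longleftrightarrow> ?diag x i = \<epsilon> i * \<rho> * f x" for x i
  proof (rule nonzero_multiple_iff)
    \<comment> \<open>On the diagonal the metric and the trace part of the Ricci tensor carry 1 /
      \<phi>^2, so one more factor \<phi> is needed.\<close>
    show "f x * (\<phi> x)\<^sup>2 \<noteq> 0"
      using nz by simp
    \<comment> \<open>Naming the sums makes them atoms, so that the remaining identity is one of
      rational functions.\<close>
    define S1 where "S1 = (\<Sum>k\<in>UNIV. \<epsilon> k * (\<phi> x * \<partial> k (\<partial> k \<phi>) x - (n - 1) * (\<partial> k \<phi> x)\<^sup>2))"
    define S2 where "S2 v = (\<Sum>k\<in>UNIV. \<epsilon> k * \<partial> k \<phi> x * \<partial> k v x)" for v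
    have S: "(\<Sum>k\<in>UNIV. \<epsilon> k * (f x * \<phi> x * \<partial> k (\<partial> k \<phi>) x
             - (n - 1) * f x * (\<partial> k \<phi> x)\<^sup>2 + m * \<phi> x * \<partial> k \<phi> x * \<partial> k f x
             - f x * \<phi> x * \<partial> k \<phi> x * \<partial> k h x)) = f x * S1 + m * \<phi> x * S2 f - f x * \<phi> x * S2 h"
      unfolding S1_def S2_def sum_distrib_left sum.distrib[symmetric] sum_subtractf[symmetric]
      by (rule sum.cong) (simp_all add: algebra_simps)
    show "f x * (\<phi> x)\<^sup>2 * (B x i i - \<rho> * chart_metric e x $ i $ i) = ?diag x i - \<epsilon> i * \<rho> * f x"
      using nz unfolding S B_def conformal_ricci conformal_hessian assms(1)[symmetric] S1_def[symmetric] S2_def[symmetric]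
      by (simp add: field_simps power2_eq_square)
  qed
  \<comment> \<open>The scalar fibre equation is the negative of condition (3), compared summand by
    summand.\<close>
  have lap: "f x * coord_laplacian e f x + (m - 1) * (\<Sum>k\<in>UNIV. \<partial> k f x * coord_gradient e f k x)
      - f x * (\<Sum>k\<in>UNIV. coord_gradient e f k x * \<partial> k h x) = - ?fib x" for x
    unfolding conformal_laplacian[OF assms(5)] conformal_gradient sum_distrib_left sum.distrib[symmetric]
      sum_subtractf[symmetric] sum_negf[symmetric] assms(1)
    by (rule sum.cong) (simp_all add: algebra_simps power2_eq_square)
  have neg: "L = - R \<Longrightarrow> L = \<Lambda> - r \<longleftrightarrow> R = r - \<Lambda>" for L R r :: real
    by linarith
  have fib: "f x * coord_laplacian e f x + (m - 1) * (\<Sum>k\<in>UNIV. \<partial> k f x * coord_gradient e f k x)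
      - f x * (\<Sum>k\<in>UNIV. coord_gradient e f k x * \<partial> k h x) = \<Lambda> - \<rho> * (f x)\<^sup>2
      \<longleftrightarrow> ?fib x = \<rho> * (f x)\<^sup>2 - \<Lambda>" for x
    by (rule neg[OF lap])
  have split: "(\<forall>x i j. P x i j) \<longleftrightarrow> (\<forall>x i j. i \<noteq> j \<longrightarrow> Q x i j) \<and> (\<forall>x i. R x i)"
    if "\<And>x i j. i \<noteq> j \<Longrightarrow> P x i j = Q x i j" "\<And>x i. P x i i = R x i"
    for P Q :: "real^'n \<Rightarrow> 'n \<Rightarrow> 'n \<Rightarrow> bool" and R
    using that by metis
  have base: "(\<forall>x i j. B x i j = \<rho> * chart_metric e x $ i $ j) \<longleftrightarrow>
      (\<forall>x. \<forall>i j. i \<noteq> j \<longrightarrow> ?off x i j = 0) \<and> (\<forall>x. \<forall>i. ?diag x i = \<epsilon> i * \<rho> * f x)"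
    by (rule split[OF off diag])
  then show ?thesis
    unfolding conformal_metric_pseudo_euclidean warped_soliton_iff[OF assms(10,11,5) f] assms(2)[symmetric]
      fib B_def[symmetric] base by (simp only: conj_assoc)
qed

end
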